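(* Let $n\ge2$ and integers $k,m\ge0$, and let $Q^{k,m}=\int_{x_1}^{x_2}t^k\prod_{i=1}^n(t-x_i)^m\,dt$. Expand $Q^{k,m}$ as a polynomial in the variables $x_1,x_3,\dots,x_n,z$ where $z=x_2-x_1$. Then for every integer $r\ge m+1$ the coefficient of $z^r$ in $Q^{k,m}$ is $$\frac{m!}{r(r-1)\cdots(r-m)}\sum_{i_3=0}^m\cdots\sum_{i_n=0}^m(-1)^{m+i_3+\dots+i_n}\binom{m}{i_3}\cdots\binom{m}{i_n}\binom{K}{r-(2m+1)}x_1^{K-(r-(2m+1))}x_3^{i_3}\cdots x_n^{i_n},$$ where $K=k+m(n-2)-i_3-\dots-i_n$, and $\binom{a}{b}=0$ when $b<0$ or $b>a$.
   Context: $Q^{k,m}$ is the polynomial $Q_T^{k,m}$ for the standard tableau $T$ of shape $[n-1,1]$ with entry $2$ in its second row. *)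

theory Defs
  imports
    "HOL-Computational_Algebra.Computational_Algebra"
    "HOL-Library.Poly_Mapping"
    "HOL-Library.FuncSet"
begin

text \<open>
  Multivariate polynomials over a coefficient ring, in the variables \<open>x\<^sub>0, x\<^sub>1, x\<^sub>2, \<dots>\<close>:
  finitely supported maps from monomials (exponent vectors) to coefficients, with the
  convolution product of \<open>Poly_Mapping\<close>.  Only \<open>x\<^sub>1, \<dots>, x\<^sub>n\<close> are used below.
\<close>

type_synonym 'a mvpoly = "(nat \<Rightarrow>\<^sub>0 nat) \<Rightarrow>\<^sub>0 'a"

definition mvar :: "nat \<Rightarrow> 'a::comm_ring_1 mvpoly" where
  "mvar i = Poly_Mapping.single (Poly_Mapping.single i 1) 1"

definition mconst :: "'a::comm_ring_1 \<Rightarrow> 'a mvpoly" where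
  "mconst c = Poly_Mapping.single 0 c"

text \<open>
  Integration with respect to \<open>t\<close> of polynomials in \<open>t\<close> whose coefficients are themselves
  polynomials in the \<open>x\<^sub>i\<close>: the antiderivative of \<open>t\<^sup>j\<close> is \<open>t\<^bsup>j+1\<^esup>/(j+1)\<close>,
  extended linearly.
\<close>

definition antideriv_t :: "'a::field_char_0 mvpoly poly \<Rightarrow> 'a mvpoly poly" where
  "antideriv_t p = (\<Sum>j\<le>degree p. monom (mconst (1 / of_nat (j + 1)) * coeff p j) (j + 1))"

definition integral_t ::
    "'a::field_char_0 mvpoly \<Rightarrow> 'a mvpoly \<Rightarrow> 'a mvpoly poly \<Rightarrow> 'a mvpoly" where
  "integral_t a b p = poly (antideriv_t p) b - poly (antideriv_t p) a"

text \<open>\<open>Q\<^bsup>k,m\<^esup> = \<integral> t\<^sup>k \<Prod>\<^sub>i (t - x\<^sub>i)\<^sup>m dt\<close> from \<open>x\<^sub>1\<close> to \<open>x\<^sub>2\<close>.\<close>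

definition Qpoly :: "nat \<Rightarrow> nat \<Rightarrow> nat \<Rightarrow> 'a::field_char_0 mvpoly" where
  "Qpoly n k m =
     integral_t (mvar 1) (mvar 2) ([:0, 1:] ^ k * (\<Prod>i=1..n. [:- mvar i, 1:] ^ m))"

text \<open>
  Rewriting a polynomial in the variables \<open>x\<^sub>1, x\<^sub>3, x\<^sub>4, \<dots>\<close> and \<open>z = x\<^sub>2 - x\<^sub>1\<close>: substitute
  \<open>x\<^sub>2 = x\<^sub>1 + z\<close>.  The result is a univariate polynomial in \<open>z\<close> with coefficients in the
  other variables.
\<close>

definition expand_z :: "'a::comm_ring_1 mvpoly \<Rightarrow> 'a mvpoly poly" where
  "expand_z q =
     (\<Sum>e\<in>Poly_Mapping.keys q. [:mconst (Poly_Mapping.lookup q e):] *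
        (\<Prod>i\<in>Poly_Mapping.keys e.
           (if i = 2 then [:mvar 1, 1:] else [:mvar i:]) ^ Poly_Mapping.lookup e i))"

text \<open>
  The binomial coefficient at integer arguments with the convention that it is \<open>0\<close> when
  \<open>b < 0\<close> or \<open>b > a\<close>.
\<close>

definition ibinom :: "int \<Rightarrow> int \<Rightarrow> nat" where
  "ibinom a b = (if b < 0 \<or> b > a then 0 else nat a choose nat b)"

text \<open>
  Two checks on the definitions: \<open>antideriv_t\<close> is the antiderivative without constant term,
  and \<open>expand_z q\<close> is a polynomial in \<open>z\<close>, with coefficients free of \<open>x\<^sub>2\<close>, that gives back
  \<open>q\<close> at \<open>z = x\<^sub>2 - x\<^sub>1\<close>.
\<close>

lemma of_nat_mconst: "of_nat k = mconst (of_nat k)"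
  by (simp add: mconst_def)

lemma mconst_mult: "mconst a * mconst b = mconst (a * b)"
  by (simp add: mconst_def mult_single)

lemma antideriv_t_Suc:
  "coeff (antideriv_t p) (Suc j) = mconst (1 / of_nat (Suc j)) * coeff p j"
proof -
  have "coeff (antideriv_t p) (Suc j) =
      (\<Sum>i\<le>degree p. if i = j then mconst (1 / of_nat (Suc i)) * coeff p i else 0)"
    by (simp add: antideriv_t_def coeff_sum if_distrib cong: if_cong)
  also have "\<dots> = mconst (1 / of_nat (Suc j)) * coeff p j"
    by (auto simp: coeff_eq_0 not_le simp del: of_nat_Suc)
  finally show ?thesis .
qed

lemma antideriv_t_0: "coeff (antideriv_t p) 0 = 0"
  by (simp add: antideriv_t_def coeff_sum)

lemma pderiv_antideriv_t: "pderiv (antideriv_t p) = p"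
proof (rule poly_eqI)
  fix j
  have "of_nat (Suc j) * mconst (1 / of_nat (Suc j) :: 'a) = mconst (1 :: 'a)"
    by (simp add: of_nat_mconst mconst_mult del: of_nat_Suc)
  then show "coeff (pderiv (antideriv_t p)) j = coeff p j"
    by (simp add: coeff_pderiv antideriv_t_Suc mult.assoc[symmetric] mconst_def
        del: of_nat_Suc)
qed

lemma mvar_power: "mvar i ^ k = Poly_Mapping.single (Poly_Mapping.single i k) (1::'a::comm_ring_1)"
  by (induction k) (simp_all add: mvar_def mult_single single_add[symmetric])

lemma prod_single_one:
  "(\<Prod>i\<in>A. Poly_Mapping.single (f i) (1::'a::comm_ring_1)) =
     Poly_Mapping.single (sum f A :: nat \<Rightarrow>\<^sub>0 nat) 1"
  by (induction A rule: infinite_finite_induct) (simp_all add: mult_single)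

lemma poly_mapping_sum_single:
  "(\<Sum>i\<in>Poly_Mapping.keys e. Poly_Mapping.single i (Poly_Mapping.lookup e i)) =
     (e :: 'b \<Rightarrow>\<^sub>0 'c::comm_monoid_add)"
proof (rule poly_mapping_eqI)
  fix k
  have "Poly_Mapping.lookup
      (\<Sum>i\<in>Poly_Mapping.keys e. Poly_Mapping.single i (Poly_Mapping.lookup e i)) k =
      (\<Sum>i\<in>Poly_Mapping.keys e. if i = k then Poly_Mapping.lookup e i else 0)"
    by (simp add: lookup_sum lookup_single when_def)
  also have "\<dots> = Poly_Mapping.lookup e k"
    by (auto simp: in_keys_iff)
  finally show "Poly_Mapping.lookup
      (\<Sum>i\<in>Poly_Mapping.keys e. Poly_Mapping.single i (Poly_Mapping.lookup e i)) k =
      Poly_Mapping.lookup e k" .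
qed

lemma poly_expand_z:
  fixes q :: "'a::comm_ring_1 mvpoly"
  shows "poly (expand_z q) (mvar 2 - mvar 1) = q"
proof -
  have monomial: "(\<Prod>i\<in>Poly_Mapping.keys e. mvar i ^ Poly_Mapping.lookup e i) =
      Poly_Mapping.single e (1::'a)" for e
    by (simp add: mvar_power prod_single_one poly_mapping_sum_single)
  have "poly (expand_z q) (mvar 2 - mvar 1) =
      (\<Sum>e\<in>Poly_Mapping.keys q. mconst (Poly_Mapping.lookup q e) *
        (\<Prod>i\<in>Poly_Mapping.keys e. mvar i ^ Poly_Mapping.lookup e i))"
    unfolding expand_z_def poly_sum poly_mult poly_prod poly_power
    by (intro sum.cong prod.cong arg_cong2[where f = "(*)"]) auto
  also have "\<dots> =
      (\<Sum>e\<in>Poly_Mapping.keys q. Poly_Mapping.single e (Poly_Mapping.lookup q e))"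
    by (simp add: monomial mconst_def mult_single)
  finally show ?thesis
    by (simp add: poly_mapping_sum_single)
qed

definition free_of_x2 :: "'a::comm_ring_1 mvpoly \<Rightarrow> bool" where
  "free_of_x2 q \<longleftrightarrow> (\<forall>e\<in>Poly_Mapping.keys q. Poly_Mapping.lookup e 2 = 0)"

lemma free_of_x2_add: "free_of_x2 p \<Longrightarrow> free_of_x2 q \<Longrightarrow> free_of_x2 (p + q)"
  using Poly_Mapping.keys_add[of p q] by (auto simp: free_of_x2_def)

lemma free_of_x2_mult: "free_of_x2 p \<Longrightarrow> free_of_x2 q \<Longrightarrow> free_of_x2 (p * q)"
  using keys_mult[of p q] by (fastforce simp: free_of_x2_def lookup_add)

lemma free_of_x2_sum: "(\<And>a. a \<in> A \<Longrightarrow> free_of_x2 (f a)) \<Longrightarrow> free_of_x2 (sum f A)"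
  by (induction A rule: infinite_finite_induct)
    (simp_all add: free_of_x2_add, simp_all add: free_of_x2_def)

lemma free_of_x2_coeff_mult:
  "\<forall>j. free_of_x2 (coeff p j) \<Longrightarrow> \<forall>j. free_of_x2 (coeff q j) \<Longrightarrow>
     \<forall>j. free_of_x2 (coeff (p * q) j)"
  by (simp add: coeff_mult free_of_x2_sum free_of_x2_mult)

lemma free_of_x2_const: "free_of_x2 (mconst c)" "free_of_x2 1" "free_of_x2 0"
  by (simp_all add: free_of_x2_def mconst_def)

lemma free_of_x2_mvar: "i \<noteq> 2 \<Longrightarrow> free_of_x2 (mvar i)"
  by (simp add: free_of_x2_def mvar_def lookup_single)

lemma free_of_x2_coeff_pCons:
  "free_of_x2 a \<Longrightarrow> \<forall>j. free_of_x2 (coeff p j) \<Longrightarrow> \<forall>j. free_of_x2 (coeff (pCons a p) j)"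
  by (simp add: coeff_pCons split: nat.split)

lemma free_of_x2_coeff_power:
  "\<forall>j. free_of_x2 (coeff p j) \<Longrightarrow> \<forall>j. free_of_x2 (coeff (p ^ k) j)"
  by (induction k) (simp_all add: free_of_x2_coeff_mult free_of_x2_const)

lemma free_of_x2_coeff_prod:
  "(\<And>a. a \<in> A \<Longrightarrow> \<forall>j. free_of_x2 (coeff (f a) j)) \<Longrightarrow>
     \<forall>j. free_of_x2 (coeff (prod f A) j)"
  by (induction A rule: infinite_finite_induct)
    (simp_all add: free_of_x2_coeff_mult free_of_x2_const)

lemma free_of_x2_expand_z: "free_of_x2 (coeff (expand_z q) j)"
proof -
  have linear: "\<forall>j. free_of_x2 (coeff (if i = 2 then [:mvar 1, 1:] else [:mvar i:]) j)" for i
    by (simp add: free_of_x2_coeff_pCons free_of_x2_mvar free_of_x2_const)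
  have "\<forall>j. free_of_x2 (coeff ([:mconst (Poly_Mapping.lookup q e):] *
        (\<Prod>i\<in>Poly_Mapping.keys e.
           (if i = 2 then [:mvar 1, 1:] else [:mvar i:]) ^ Poly_Mapping.lookup e i)) j)" for e
    by (intro free_of_x2_coeff_mult free_of_x2_coeff_prod free_of_x2_coeff_power linear
        free_of_x2_coeff_pCons free_of_x2_const) (simp add: free_of_x2_const)
  then show ?thesis
    unfolding expand_z_def coeff_sum by (intro free_of_x2_sum) blast
qed

end

theory Submission
  imports Defs
begin

text \<open>
  Expand each \<open>(t - x\<^sub>s)\<^sup>m\<close> with \<open>s \<ge> 3\<close> in powers of \<open>t\<close>, and each resulting \<open>t\<^sup>K\<close> in powers of
  \<open>t - x\<^sub>1\<close>.  What remains are the beta integrals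
  \<open>\<integral> (t - x\<^sub>1)\<^bsup>m+b\<^esup> (t - x\<^sub>2)\<^sup>m dt\<close> from \<open>x\<^sub>1\<close> to \<open>x\<^sub>2\<close>; repeated integration by parts turns each of
  them into a rational multiple of \<open>(x\<^sub>2 - x\<^sub>1)\<^bsup>2m+b+1\<^esup>\<close>.  Thus \<open>Q\<^bsup>k,m\<^esup>\<close> is written as
  a polynomial in \<open>x\<^sub>2 - x\<^sub>1\<close> with coefficients free of \<open>x\<^sub>2\<close>.  Since \<open>expand_z\<close> is a ring
  homomorphism that sends \<open>x\<^sub>2 - x\<^sub>1\<close> to \<open>z\<close> and fixes the other variables, the coefficient of
  \<open>z\<^sup>r\<close> is the contribution of \<open>b = r - (2m + 1)\<close>.
\<close>

subsection \<open>Substituting \<open>x\<^sub>2 = x\<^sub>1 + z\<close> is a ring homomorphism\<close>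

lemma mconst_0 [simp]: "mconst 0 = 0"
  by (simp add: mconst_def)

lemma mconst_1 [simp]: "mconst 1 = 1"
  by (simp add: mconst_def)

lemma mconst_add: "mconst (a + b) = mconst a + mconst b"
  by (simp add: mconst_def single_add)

lemma mconst_uminus: "mconst (- a) = - mconst a"
  by (simp add: mconst_def single_uminus)

lemma mconst_power: "mconst (a ^ k) = mconst a ^ k"
  by (induction k) (simp_all add: mconst_mult[symmetric])

lemma mconst_prod: "mconst (prod f A) = (\<Prod>a\<in>A. mconst (f a))"
  by (induction A rule: infinite_finite_induct) (simp_all add: mconst_mult[symmetric])

definition zmonom :: "(nat \<Rightarrow>\<^sub>0 nat) \<Rightarrow> 'a::comm_ring_1 mvpoly poly" where
  "zmonom e = (\<Prod>i\<in>Poly_Mapping.keys e.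
     (if i = 2 then [:mvar 1, 1:] else [:mvar i:]) ^ Poly_Mapping.lookup e i)"

text \<open>Indices outside the support have exponent 0 and contribute 1, so the products for
  \<open>d\<close>, \<open>e\<close> and \<open>d + e\<close> can be compared over one index
  set.\<close>

lemma zmonom_superset:
  assumes "finite A" "Poly_Mapping.keys e \<subseteq> A"
  shows "zmonom e = (\<Prod>i\<in>A.
    (if i = 2 then [:mvar 1, 1:] else [:mvar i:]) ^ Poly_Mapping.lookup e i)"
  unfolding zmonom_def using assms
  by (intro prod.mono_neutral_left) (auto simp: in_keys_iff)

lemma zmonom_add: "zmonom (d + e) = zmonom d * zmonom e"
proof -
  let ?A = "Poly_Mapping.keys d \<union> Poly_Mapping.keys e"
  have "zmonom (d + e) = (\<Prod>i\<in>?A.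
    (if i = 2 then [:mvar 1, 1:] else [:mvar i:]) ^ Poly_Mapping.lookup (d + e) i)"
    using Poly_Mapping.keys_add[of d e] by (intro zmonom_superset) auto
  then show ?thesis
    by (simp add: zmonom_superset[of ?A d] zmonom_superset[of ?A e]
        lookup_add power_add prod.distrib)
qed

text \<open>Exponent vectors outside the support carry coefficient 0, so a common index set serves
  \<open>p\<close>, \<open>q\<close> and \<open>p + q\<close> even when terms cancel.\<close>

lemma expand_z_superset:
  assumes "finite A" "Poly_Mapping.keys q \<subseteq> A"
  shows "expand_z q = (\<Sum>e\<in>A. [:mconst (Poly_Mapping.lookup q e):] * zmonom e)"
  unfolding expand_z_def zmonom_def[symmetric] using assms
  by (intro sum.mono_neutral_left) (auto simp: in_keys_iff)

lemma expand_z_single: "expand_z (Poly_Mapping.single e c) = [:mconst c:] * zmonom e"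
  by (simp add: expand_z_superset[of "{e}"])

lemma expand_z_0 [simp]: "expand_z 0 = 0"
  by (simp add: expand_z_def)

lemma expand_z_add: "expand_z (p + q) = expand_z p + expand_z q"
proof -
  let ?A = "Poly_Mapping.keys p \<union> Poly_Mapping.keys q"
  have "expand_z (p + q) =
      (\<Sum>e\<in>?A. [:mconst (Poly_Mapping.lookup (p + q) e):] * zmonom e)"
    using Poly_Mapping.keys_add[of p q] by (intro expand_z_superset) auto
  also have "\<dots> = (\<Sum>e\<in>?A. [:mconst (Poly_Mapping.lookup p e):] * zmonom e +
      [:mconst (Poly_Mapping.lookup q e):] * zmonom e)"
    by (intro sum.cong refl) (simp add: lookup_add mconst_add smult_add_left)
  also have "\<dots> = expand_z p + expand_z q"
    by (simp only: sum.distrib) (simp add: expand_z_superset[of ?A p] expand_z_superset[of ?A q])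
  finally show ?thesis .
qed

lemma expand_z_sum: "expand_z (sum f A) = (\<Sum>a\<in>A. expand_z (f a))"
  by (induction A rule: infinite_finite_induct) (simp_all add: expand_z_add)

text \<open>Both sides are additive in each argument, so single terms suffice, and there
  \<open>zmonom_add\<close> applies.\<close>

lemma expand_z_mult: "expand_z (p * q) = expand_z p * expand_z q"
proof -
  have decomp: "q = (\<Sum>e\<in>Poly_Mapping.keys q.
      Poly_Mapping.single e (Poly_Mapping.lookup q e))" for q :: "'a mvpoly"
    by (simp add: poly_mapping_sum_single)
  have single: "expand_z (Poly_Mapping.single d a * Poly_Mapping.single e b) =
      expand_z (Poly_Mapping.single d a) * expand_z (Poly_Mapping.single e (b::'a))" for d e a b
    by (simp add: mult_single expand_z_single zmonom_add mconst_mult[symmetric] ac_simps)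
  show ?thesis
    \<comment> \<open>The variable recurs on the right of \<open>decomp\<close>, which would loop as
      a rewrite rule.\<close>
    by (subst decomp[of p], subst (2) decomp[of p], subst decomp[of q], subst (2) decomp[of q])
      (simp only: expand_z_sum sum_product single)
qed

lemma expand_z_mconst [simp]: "expand_z (mconst c) = [:mconst c:]"
  by (simp add: mconst_def[of c] expand_z_single) (simp add: mconst_def zmonom_def one_pCons)

lemma expand_z_1 [simp]: "expand_z 1 = 1"
  using expand_z_mconst[of 1] by (simp add: one_pCons)

lemma expand_z_power: "expand_z (q ^ k) = expand_z q ^ k"
  by (induction k) (simp_all add: expand_z_mult)

lemma expand_z_prod: "expand_z (prod f A) = (\<Prod>a\<in>A. expand_z (f a))"
  by (induction A rule: infinite_finite_induct) (simp_all add: expand_z_mult)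

lemma expand_z_mvar: "expand_z (mvar i) = (if i = 2 then [:mvar 1, 1:] else [:mvar i:])"
  by (simp add: mvar_def[of i] expand_z_single zmonom_def)

lemma expand_z_diff: "expand_z (p - q) = expand_z p - expand_z q"
  using expand_z_add[of "p - q" q] by simp

lemma expand_z_z: "expand_z (mvar 2 - mvar 1) = [:0, 1:]"
  by (simp add: expand_z_diff expand_z_mvar)

subsection \<open>Integration by parts\<close>

text \<open>Differentiation loses only the constant coefficient, and \<open>antideriv_t\<close>
  always puts 0 there.\<close>

lemma antideriv_t_pderiv: "antideriv_t (pderiv F) = F - [:coeff F 0:]"
proof (rule poly_eqI)
  fix j
  show "coeff (antideriv_t (pderiv F)) j = coeff (F - [:coeff F 0:]) j"
  proof (cases j)
    case (Suc i)
    have "mconst (1 / of_nat (Suc i) :: 'a) * of_nat (Suc i) = 1"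
      by (simp add: of_nat_mconst mconst_mult del: of_nat_Suc)
    then show ?thesis
      by (simp add: Suc antideriv_t_Suc coeff_pderiv mult.assoc[symmetric] del: of_nat_Suc)
  qed (simp add: antideriv_t_0)
qed

lemma integral_t_pderiv: "integral_t a b (pderiv F) = poly F b - poly F a"
  by (simp add: integral_t_def antideriv_t_pderiv)

lemma antideriv_t_add: "antideriv_t (p + q) = antideriv_t p + antideriv_t q"
proof (rule poly_eqI)
  fix j
  show "coeff (antideriv_t (p + q)) j = coeff (antideriv_t p + antideriv_t q) j"
    by (cases j) (simp_all add: antideriv_t_0 antideriv_t_Suc distrib_left)
qed

lemma antideriv_t_smult: "antideriv_t (smult c p) = smult c (antideriv_t p)"
proof (rule poly_eqI)
  fix j
  show "coeff (antideriv_t (smult c p)) j = coeff (smult c (antideriv_t p)) j"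
    by (cases j) (simp_all add: antideriv_t_0 antideriv_t_Suc mult.left_commute)
qed

lemma integral_t_add: "integral_t a b (p + q) = integral_t a b p + integral_t a b q"
  by (simp add: integral_t_def antideriv_t_add)

lemma integral_t_smult: "integral_t a b (smult c p) = c * integral_t a b p"
  by (simp add: integral_t_def antideriv_t_smult right_diff_distrib)

lemma integral_t_sum: "integral_t a b (sum f A) = (\<Sum>i\<in>A. integral_t a b (f i))"
  \<comment> \<open>The scalar 0 shows that the zero polynomial has integral 0, which is the empty
    sum.\<close>
  using integral_t_smult[of a b 0]
  by (induction A rule: infinite_finite_induct) (simp_all add: integral_t_add)

text \<open>Integration by parts trades a factor \<open>t - b\<close> for a factor
  \<open>t - a\<close>, so the induction on \<open>q\<close> lets \<open>p\<close> vary. The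
  denominator stays a falling product from \<open>p + q + 1\<close> to \<open>p + 1\<close> because
  it becomes \<open>r(r-1)...(r-m)\<close> for \<open>q = m\<close> and
  \<open>p + q + 1 = r\<close>.\<close>

lemma integral_t_beta:
  "integral_t a b ([:- a, 1:] ^ p * [:- b, 1:] ^ q) =
     mconst ((-1) ^ q * fact q / (\<Prod>j=0..q. of_nat (p + q + 1) - of_nat j)) *
       (b - a) ^ (p + q + 1)"
proof (induction q arbitrary: p)
  case 0
  have "integral_t a b ([:- a, 1:] ^ p) =
      mconst (1 / of_nat (Suc p)) * integral_t a b (pderiv ([:- a, 1:] ^ Suc p))"
    by (simp add: pderiv_power_Suc pderiv_pCons integral_t_smult of_nat_mconst mconst_mult
        mult.assoc[symmetric] del: of_nat_Suc power_Suc)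
  also have "integral_t a b (pderiv ([:- a, 1:] ^ Suc p)) = (b - a) ^ Suc p"
    by (simp add: integral_t_pderiv left_diff_distrib)
  finally show ?case
    by simp
next
  case (Suc q)
  let ?A = "[:- a, 1:]" and ?B = "[:- b, 1:]"
  let ?d = "\<Prod>j=0..q. of_nat (Suc p + q + 1) - of_nat j :: 'a"
  have "pderiv (?A ^ Suc p * ?B ^ Suc q) =
      smult (of_nat (Suc p)) (?A ^ p * ?B ^ Suc q) + smult (of_nat (Suc q)) (?A ^ Suc p * ?B ^ q)"
    by (simp add: pderiv_mult pderiv_power_Suc pderiv_pCons mult.commute del: of_nat_Suc power_Suc)
  \<comment> \<open>Both exponents are positive, so the product vanishes at \<open>a\<close> and at
    \<open>b\<close>: there is no boundary term.\<close>
  then have "of_nat (Suc p) * integral_t a b (?A ^ p * ?B ^ Suc q) +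
      of_nat (Suc q) * integral_t a b (?A ^ Suc p * ?B ^ q) = 0"
    using integral_t_pderiv[of a b "?A ^ Suc p * ?B ^ Suc q"]
    by (simp add: integral_t_add integral_t_smult del: of_nat_Suc)
  then have parts: "mconst (of_nat (Suc p)) * integral_t a b (?A ^ p * ?B ^ Suc q) =
      mconst (- of_nat (Suc q)) * integral_t a b (?A ^ Suc p * ?B ^ q)"
    by (simp add: of_nat_mconst mconst_uminus eq_neg_iff_add_eq_0 del: of_nat_Suc)
  \<comment> \<open>The values lie in a polynomial ring, so division by \<open>p + 1\<close> is
    multiplication by a rational constant.\<close>
  have "integral_t a b (?A ^ p * ?B ^ Suc q) = mconst (1 / of_nat (Suc p)) *
      (mconst (of_nat (Suc p)) * integral_t a b (?A ^ p * ?B ^ Suc q))"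
    by (simp add: mult.assoc[symmetric] mconst_mult del: of_nat_Suc)
  also have "\<dots> = mconst (1 / of_nat (Suc p) * (- of_nat (Suc q)) *
      ((-1) ^ q * fact q / ?d)) * (b - a) ^ (Suc p + q + 1)"
    unfolding parts Suc.IH by (simp only: mult.assoc[symmetric] mconst_mult)
  also have "1 / of_nat (Suc p) * (- of_nat (Suc q)) * ((-1) ^ q * fact q / ?d) =
      ((-1) ^ Suc q * fact (Suc q) / (\<Prod>j=0..Suc q. of_nat (p + Suc q + 1) - of_nat j) :: 'a)"
  proof -
    \<comment> \<open>The factor at \<open>j = Suc q\<close> is \<open>p + 1\<close>; the others
      make up \<open>?d\<close>.\<close>
    have "(\<Prod>j=0..Suc q. of_nat (p + Suc q + 1) - of_nat j) = ?d * of_nat (Suc p)"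
      by (simp add: algebra_simps)
    then show ?thesis
      by (simp add: divide_inverse ac_simps del: of_nat_Suc of_nat_add)
  qed
  finally show ?case
    by simp
qed

subsection \<open>The coefficients of the expansion\<close>

text \<open>General distributivity, by splitting a choice function on \<open>insert a A\<close> into
  its value at \<open>a\<close> and the rest. It produces the multiple sum over the tuples
  \<open>i\<close>.\<close>

lemma prod_sum_PiE:
  fixes f :: "'b \<Rightarrow> 'c \<Rightarrow> 'd::comm_semiring_1"
  assumes "finite A" "\<And>x. x \<in> A \<Longrightarrow> finite (B x)"
  shows "(\<Prod>x\<in>A. \<Sum>y\<in>B x. f x y) = (\<Sum>g\<in>PiE A B. \<Prod>x\<in>A. f x (g x))"
  using assms
proof (induction A rule: finite_induct)
  case (insert a A)
  have upd: "(\<Prod>x\<in>A. f x ((g(a := y)) x)) = (\<Prod>x\<in>A. f x (g x))" for g y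
    using insert.hyps by (intro prod.cong) auto
  have "(\<Sum>g\<in>PiE (insert a A) B. \<Prod>x\<in>insert a A. f x (g x)) =
      (\<Sum>(y, g)\<in>B a \<times> PiE A B. f a y * (\<Prod>x\<in>A. f x (g x)))"
    unfolding PiE_insert_eq using insert.hyps
    by (subst sum.reindex[OF inj_combinator]) (simp_all add: upd case_prod_beta fun_upd_same del: fun_upd_apply)
  then show ?case
    using insert by (simp add: sum_product sum.cartesian_product)
qed simp

lemma linear_power_expansion:
  fixes a b :: "'a::comm_ring_1"
  shows "[:- a, 1:] ^ m =
    (\<Sum>j\<le>m. smult (of_nat (m choose j) * (b - a) ^ j) ([:- b, 1:] ^ (m - j)))"
proof -
  have "[:- a, 1:] = [:b - a:] + [:- b, 1:]"
    by simp
  then show ?thesis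
    by (simp only: binomial_ring) (simp add: poly_const_pow of_nat_poly mult.commute)
qed

lemma power_t_expansion:
  fixes a :: "'a::comm_ring_1"
  shows "[:0, 1:] ^ N = (\<Sum>b\<le>N. smult (of_nat (N choose b) * a ^ (N - b)) ([:- a, 1:] ^ b))"
proof -
  have "[:0, 1:] = [:- a, 1:] + [:a:]"
    by simp
  then show ?thesis
    by (simp only: binomial_ring) (simp add: poly_const_pow of_nat_poly mult.commute)
qed

lemma smult_sum_right: "smult c (sum f A) = (\<Sum>a\<in>A. smult c (f a))"
  by (induction A rule: infinite_finite_induct) (simp_all add: smult_add_right)

text \<open>The binomial theorem in each factor: \<open>i s\<close> counts the choices of
  \<open>- x s\<close>, which leaves \<open>m - i s\<close> choices of \<open>t\<close>.\<close>

lemma prod_linear_power_expansion: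
  fixes x :: "'b \<Rightarrow> 'a::comm_ring_1"
  assumes "finite S"
  shows "[:0, 1:] ^ k * (\<Prod>s\<in>S. [:- x s, 1:] ^ m) =
    (\<Sum>i\<in>PiE S (\<lambda>_. {0..m}). smult (\<Prod>s\<in>S. of_nat (m choose i s) * (- x s) ^ i s)
       ([:0, 1:] ^ (k + (\<Sum>s\<in>S. m - i s))))"
proof -
  have "(\<Prod>s\<in>S. [:- x s, 1:] ^ m) = (\<Sum>i\<in>PiE S (\<lambda>_. {0..m}).
      \<Prod>s\<in>S. smult (of_nat (m choose i s) * (- x s) ^ i s) ([:0, 1:] ^ (m - i s)))"
    using assms by (simp add: linear_power_expansion[where b = 0] atMost_atLeast0 prod_sum_PiE)
  then show ?thesis
    by (simp add: prod_smult power_sum power_add sum_distrib_left)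
qed

lemma Qpoly_expansion:
  assumes "n \<ge> 2"
  shows "(Qpoly n k m :: 'a::field_char_0 mvpoly) =
    (\<Sum>i\<in>PiE {3..n} (\<lambda>_. {0..m}). \<Sum>b\<le>k + (\<Sum>s=3..n. m - i s).
       (\<Prod>s=3..n. of_nat (m choose i s) * (- mvar s) ^ i s) *
       (of_nat ((k + (\<Sum>s=3..n. m - i s)) choose b) *
          mvar 1 ^ ((k + (\<Sum>s=3..n. m - i s)) - b)) *
       (mconst ((-1) ^ m * fact m / (\<Prod>j=0..m. of_nat (m + b + m + 1) - of_nat j)) *
          (mvar 2 - mvar 1) ^ (m + b + m + 1)))"
proof -
  let ?A = "[:- mvar 1, 1:] :: 'a mvpoly poly" and ?B = "[:- mvar 2, 1:] :: 'a mvpoly poly"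
  have "{1..n} = insert 1 (insert 2 {3..n})"
    using assms by auto
  then have "[:0, 1:] ^ k * (\<Prod>i=1..n. [:- mvar i, 1:] ^ m) =
      (?A ^ m * ?B ^ m) * ([:0, 1:] ^ k * (\<Prod>s=3..n. [:- mvar s, 1:] ^ m))"
    by (simp add: ac_simps)
  also have "\<dots> = (\<Sum>i\<in>PiE {3..n} (\<lambda>_. {0..m}). \<Sum>b\<le>k + (\<Sum>s=3..n. m - i s).
      smult ((\<Prod>s=3..n. of_nat (m choose i s) * (- mvar s) ^ i s) *
       (of_nat ((k + (\<Sum>s=3..n. m - i s)) choose b) *
          mvar 1 ^ ((k + (\<Sum>s=3..n. m - i s)) - b))) (?A ^ (m + b) * ?B ^ m))"
    \<comment> \<open>All powers of \<open>t\<close> are collected first; only the total power is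
      then re-expanded about \<open>mvar 1\<close>, to merge with \<open>?A ^ m\<close>.\<close>
    unfolding prod_linear_power_expansion[OF finite_atLeastAtMost]
    unfolding power_t_expansion[where a = "mvar 1"]
    by (simp add: sum_distrib_left smult_sum_right power_add ac_simps)
  finally show ?thesis
    unfolding Qpoly_def by (simp only: integral_t_sum integral_t_smult integral_t_beta)
qed

lemma expand_z_of_nat [simp]: "expand_z (of_nat j) = [:of_nat j:]"
  by (simp add: of_nat_mconst)

text \<open>Apart from its power of \<open>mvar 2 - mvar 1\<close>, each summand is free of
  \<open>x\<^sub>2\<close>, so it contributes to exactly one power of \<open>z\<close>.\<close>

lemma coeff_expand_z_Qpoly:
  assumes "n \<ge> 2"
  shows "coeff (expand_z (Qpoly n k m :: 'a::field_char_0 mvpoly)) r =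
    (\<Sum>i\<in>PiE {3..n} (\<lambda>_. {0..m}). \<Sum>b\<le>k + (\<Sum>s=3..n. m - i s).
       if m + b + m + 1 = r then
         (\<Prod>s=3..n. of_nat (m choose i s) * (- mvar s) ^ i s) *
         (of_nat ((k + (\<Sum>s=3..n. m - i s)) choose b) *
            mvar 1 ^ ((k + (\<Sum>s=3..n. m - i s)) - b)) *
         mconst ((-1) ^ m * fact m / (\<Prod>j=0..m. of_nat r - of_nat j))
       else 0)"
proof -
  have summand: "coeff (expand_z (c * (of_nat N * mvar 1 ^ e) *
      (mconst d * (mvar 2 - mvar 1 :: 'a mvpoly) ^ l))) r =
      (if l = r then c * (of_nat N * mvar 1 ^ e) * mconst d else 0)"
    \<comment> \<open>This condition expresses that \<open>c\<close> does not involve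
      \<open>x\<^sub>2\<close>.\<close>
    if "expand_z c = [:c:]" for c N e d l
  proof -
    have "expand_z (c * (of_nat N * mvar 1 ^ e) * (mconst d * (mvar 2 - mvar 1) ^ l)) =
        smult (c * (of_nat N * mvar 1 ^ e) * mconst d) (monom 1 l)"
      by (simp add: expand_z_mult expand_z_power expand_z_mvar expand_z_z[simplified] that
          poly_const_pow monom_altdef ac_simps)
    then show ?thesis
      by simp
  qed
  have const: "expand_z (\<Prod>s=3..n. of_nat (m choose i s) * (- mvar s) ^ i s) =
      [:\<Prod>s=3..n. of_nat (m choose i s) * (- mvar s :: 'a mvpoly) ^ i s:]" for i
  proof -
    have prod_const: "(\<Prod>s\<in>S. [:f s:]) = [:\<Prod>s\<in>S. f s:]"
      for S and f :: "nat \<Rightarrow> 'a mvpoly"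
      by (induction S rule: infinite_finite_induct) (simp_all add: one_pCons)
    have "expand_z (- mvar s :: 'a mvpoly) = [:- mvar s:]" if "s \<in> {3..n}" for s
      using that expand_z_diff[of 0 "mvar s"] by (simp add: expand_z_mvar)
    then show ?thesis
      unfolding prod_const[symmetric] expand_z_prod
      by (intro prod.cong refl) (simp add: expand_z_mult expand_z_power poly_const_pow)
  qed
  show ?thesis
    unfolding Qpoly_expansion[OF assms] expand_z_sum coeff_sum summand[OF const]
    by (intro sum.cong if_cong refl) simp
qed

theorem theorem6p1:
  fixes n k m r :: nat
  assumes "n \<ge> 2" and "r \<ge> m + 1"
  shows "coeff (expand_z (Qpoly n k m :: 'a::field_char_0 mvpoly)) r =
    mconst (fact m / (\<Prod>j=0..m. of_nat r - of_nat j)) *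
    (\<Sum>i\<in>PiE {3..n} (\<lambda>_. {0..m}).
       let K = int k + int m * (int n - 2) - (\<Sum>s=3..n. int (i s));
           b = int r - (2 * int m + 1)
       in mconst ((-1) ^ (m + (\<Sum>s=3..n. i s)) * (\<Prod>s=3..n. of_nat (m choose i s))
                    * of_nat (ibinom K b))
          * mvar 1 ^ nat (K - b) * (\<Prod>s=3..n. mvar s ^ i s))"
  unfolding coeff_expand_z_Qpoly[OF assms(1)] sum_distrib_left
proof (rule sum.cong[OF refl])
  fix i assume i: "i \<in> PiE {3..n} (\<lambda>_. {0..m})"
  define N where "N = k + (\<Sum>s=3..n. m - i s)"
  define D where "D = (\<Prod>j=0..m. of_nat r - of_nat j :: 'a)"
  \<comment> \<open>Since \<open>i s \<le> m\<close>, the truncated subtraction is exact; hence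
    \<open>N\<close> is the integer \<open>K\<close>.\<close>
  have "(\<Sum>s=3..n. int (m - i s)) = (\<Sum>s=3..n. int m - int (i s))"
    using i by (intro sum.cong refl) (auto simp: PiE_iff of_nat_diff)
  then have N: "int k + int m * (int n - 2) - (\<Sum>s=3..n. int (i s)) = int N"
    using assms(1) by (simp add: N_def sum_subtractf of_nat_diff algebra_simps)
  have C: "(\<Prod>s=3..n. of_nat (m choose i s) * (- mvar s :: 'a mvpoly) ^ i s) =
      mconst ((-1) ^ (\<Sum>s=3..n. i s) * (\<Prod>s=3..n. of_nat (m choose i s))) *
      (\<Prod>s=3..n. mvar s ^ i s)"
  proof -
    have "(- mvar s :: 'a mvpoly) = mconst (-1) * mvar s" for s
      by (simp add: mconst_uminus)
    then show ?thesis
      by (simp only: of_nat_mconst power_mult_distrib prod.distrib power_sum mconst_power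
          mconst_prod mconst_mult[symmetric] ac_simps)
  qed
  show "(\<Sum>b\<le>k + (\<Sum>s=3..n. m - i s). if m + b + m + 1 = r then
         (\<Prod>s=3..n. of_nat (m choose i s) * (- mvar s :: 'a mvpoly) ^ i s) *
         (of_nat ((k + (\<Sum>s=3..n. m - i s)) choose b) *
            mvar 1 ^ ((k + (\<Sum>s=3..n. m - i s)) - b)) *
         mconst ((-1) ^ m * fact m / (\<Prod>j=0..m. of_nat r - of_nat j))
       else 0) =
    mconst (fact m / (\<Prod>j=0..m. of_nat r - of_nat j)) *
      (let K = int k + int m * (int n - 2) - (\<Sum>s=3..n. int (i s));
           b = int r - (2 * int m + 1)
       in mconst ((-1) ^ (m + (\<Sum>s=3..n. i s)) * (\<Prod>s=3..n. of_nat (m choose i s))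
                    * of_nat (ibinom K b))
          * mvar 1 ^ nat (K - b) * (\<Prod>s=3..n. mvar s ^ i s))"
  proof (cases "2 * m + 1 \<le> r \<and> r - (2 * m + 1) \<le> N")
    case False
    \<comment> \<open>Here \<open>r - (2m + 1)\<close> is negative or exceeds \<open>N\<close>: the
      convention for \<open>ibinom\<close> gives 0, and no \<open>b\<close> in range matches
      \<open>r\<close>.\<close>
    then have "ibinom (int N) (int r - (2 * int m + 1)) = 0"
      by (auto simp: ibinom_def)
    moreover have "m + b + m + 1 \<noteq> r" if "b \<le> N" for b
      using False that by linarith
    ultimately show ?thesis
      unfolding N Let_def N_def[symmetric] D_def[symmetric] C by simp
  next
    case True
    \<comment> \<open>The sum over \<open>b\<close> collapses to this index, where
      \<open>ibinom\<close> is the ordinary binomial coefficient.\<close>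
    define c where "c = r - (2 * m + 1)"
    have c: "int r - (2 * int m + 1) = int c" "c \<le> N" "m + b + m + 1 = r \<longleftrightarrow> b = c" for b
      using True by (auto simp: c_def)
    show ?thesis
      using c(2) unfolding N Let_def N_def[symmetric] D_def[symmetric] C c
      by (simp add: ibinom_def of_nat_mconst power_add divide_inverse mconst_mult[symmetric]
          of_nat_diff[symmetric] ac_simps del: of_nat_diff)
  qed
qed

end
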